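(* Let $p$ be a positive integer and let $G$ be a $\{\text{butterfly},\text{hammer},P_4+K_p\}$-free graph such that no connected component of $G$ has clique number two. Then $$\chi(G)\leq \begin{cases} \omega(G)+\frac{p(p+1)}{2} & \text{if } 1\leq \omega(G)\leq p+1,\\ \omega(G)+\frac{p(p+1)}{2}-1 & \text{if } \omega(G)\geq p+2.\end{cases}$$
   Context: All graphs are simple, finite and undirected. $\omega(G)$ is the clique number and $\chi(G)$ the chromatic number of $G$. For a family $\mathcal{F}$ of graphs, $G$ is $\mathcal{F}$-free if it has no induced subgraph isomorphic to a member of $\mathcal{F}$. The butterfly is the graph on five vertices consisting of two triangles sharing exactly one vertex (with no other edges). The hammer is the graph on five vertices $a,b,c,d,e$ with edges $ab,bc,ac,cd,de$. $P_4$ is the path on four vertices and $K_p$ the complete graph on $p$ vertices. For vertex-disjoint graphs $G_1,G_2$, the join $G_1+G_2$ is obtained from their disjoint union by adding all edges between $V(G_1)$ and $V(G_2)$. *)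

theory Defs
  imports "Graph_Theory.Digraph_Isomorphism"
begin

text \<open>
  A simple finite undirected graph is a \<^locale>\<open>pair_graph\<close>: a finite vertex set together with a
  symmetric irreflexive set of ordered pairs, so that each undirected edge \<open>uv\<close> is represented by
  the two arcs \<open>(u, v)\<close> and \<open>(v, u)\<close>. The invariants below are defined on \<^type>\<open>pre_digraph\<close> so that
  they also apply to subgraphs and components, which have that type in the library. For a symmetric
  graph, the strongly connected components are the usual connected components.
\<close>

definition is_clique :: "('a, 'b) pre_digraph \<Rightarrow> 'a set \<Rightarrow> bool" where
  "is_clique G S \<longleftrightarrow> S \<subseteq> verts G \<and> (\<forall>u\<in>S. \<forall>v\<in>S. u \<noteq> v \<longrightarrow> u \<rightarrow>\<^bsub>G\<^esub> v)"

definition clique_number :: "('a, 'b) pre_digraph \<Rightarrow> nat" where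
  "clique_number G = Max {card S | S. is_clique G S}"

definition proper_colouring :: "('a, 'b) pre_digraph \<Rightarrow> nat \<Rightarrow> ('a \<Rightarrow> nat) \<Rightarrow> bool" where
  "proper_colouring G k c \<longleftrightarrow>
     (\<forall>v\<in>verts G. c v < k) \<and> (\<forall>u\<in>verts G. \<forall>v\<in>verts G. u \<rightarrow>\<^bsub>G\<^esub> v \<longrightarrow> c u \<noteq> c v)"

definition chromatic_number :: "('a, 'b) pre_digraph \<Rightarrow> nat" where
  "chromatic_number G = (LEAST k. \<exists>c. proper_colouring G k c)"

definition family_free :: "'c pair_pre_digraph set \<Rightarrow> ('a, 'b) pre_digraph \<Rightarrow> bool" where
  "family_free \<F> G \<longleftrightarrow>
     \<not> (\<exists>X\<in>\<F>. \<exists>H. induced_subgraph H G \<and> digraph_iso (with_proj X) H)"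

text \<open>The undirected graph on \<open>V\<close> in which each edge is listed in \<open>E\<close> in at least one orientation.\<close>

definition undirected_graph :: "'a set \<Rightarrow> ('a \<times> 'a) set \<Rightarrow> 'a pair_pre_digraph" where
  "undirected_graph V E = \<lparr> pverts = V, parcs = E \<union> E\<inverse> \<rparr>"

definition butterfly :: "nat pair_pre_digraph" where
  "butterfly = undirected_graph {0, 1, 2, 3, 4} {(0, 1), (1, 2), (0, 2), (0, 3), (3, 4), (0, 4)}"

definition hammer :: "nat pair_pre_digraph" where
  "hammer = undirected_graph {0, 1, 2, 3, 4} {(0, 1), (1, 2), (0, 2), (2, 3), (3, 4)}"

definition path_graph :: "nat \<Rightarrow> nat pair_pre_digraph" where
  "path_graph n = undirected_graph {..<n} {(i, Suc i) | i. Suc i < n}"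

definition complete_graph :: "'a set \<Rightarrow> 'a pair_pre_digraph" where
  "complete_graph V = undirected_graph V {(u, v). u \<in> V \<and> v \<in> V \<and> u \<noteq> v}"

text \<open>Only meaningful when the two vertex sets are disjoint.\<close>

definition graph_join :: "'a pair_pre_digraph \<Rightarrow> 'a pair_pre_digraph \<Rightarrow> 'a pair_pre_digraph" where
  "graph_join G H = undirected_graph (pverts G \<union> pverts H)
     (parcs G \<union> parcs H \<union> pverts G \<times> pverts H)"

text \<open>The path occupies the vertices \<open>0, \<dots>, 3\<close>, so the complete graph is placed on the next \<open>p\<close> numbers.\<close>

definition P4_join_K :: "nat \<Rightarrow> nat pair_pre_digraph" where
  "P4_join_K p = graph_join (path_graph 4) (complete_graph {4..<4 + p})"

end

theory Submission
  imports Defs "HOL-Library.Nat_Bijection"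
begin

text \<open>
  In a component of clique number \<open>w \<ge> 3\<close> fix a maximum clique \<open>a\<^sub>0, \<dots>\<close> and let \<open>missed x\<close> be
  the set of indices \<open>i\<close> with \<open>x\<close> not adjacent to \<open>a\<^sub>i\<close>. It is never empty by maximality. Excluding
  butterflies and hammers makes \<open>missed x\<close> and \<open>missed y\<close> share at most one index when \<open>x\<close> and \<open>y\<close> are
  adjacent; if they share one, maximality makes them differ, and an index in the difference gives an
  induced \<open>P\<^sub>4\<close> joined to all \<open>a\<^sub>l\<close> missed by neither, so there are fewer than \<open>p\<close> such \<open>l\<close>.
  Hence one may colour \<open>x\<close> by a pair of indices \<open>i < j \<le> p\<close> in \<open>missed x\<close> if there is one, and by
  a single suitable missed index otherwise, which costs \<open>p (p + 1) / 2 + w\<close> colours. For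
  \<open>w \<ge> p + 2\<close> the pair \<open>(p - 1, p)\<close> can be spared: vertices whose missed indices up to \<open>p + 1\<close>
  form a two-element subset of \<open>{p - 1, p, p + 1}\<close> are coloured by one of the two indices, chosen
  cyclically, and those missing all three of these can use one of the three as well, since otherwise
  they would have a neighbour missing exactly each one of them, which forces an induced \<open>P\<^sub>4 + K\<^sub>p\<close>.
\<close>

section \<open>Induced copies of a forbidden graph\<close>

text \<open>Arcs are ordered pairs, so a vertex map \<open>f\<close> acts on them by
  \<open>map_prod f f\<close>; an injection that preserves and reflects arcs is then an isomorphism
  onto the subgraph induced on its image.\<close>

lemma family_free_embedding:
  assumes "family_free \<F> (with_proj G)" "X \<in> \<F>" "pair_wf_digraph G" "pair_wf_digraph X"
    and inj: "inj_on f (pverts X)" and sub: "f ` pverts X \<subseteq> pverts G"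
    and arcs: "\<And>u v. u \<in> pverts X \<Longrightarrow> v \<in> pverts X \<Longrightarrow> (u, v) \<in> parcs X \<longleftrightarrow> (f u, f v) \<in> parcs G"
  shows False
proof -
  interpret G: pair_wf_digraph G by fact
  interpret X: pair_wf_digraph X by fact
  define h where "h = \<lparr>iso_verts = f, iso_arcs = map_prod f f, iso_head = snd, iso_tail = fst\<rparr>"
  define H where "H = with_proj G \<restriction> (f ` pverts X)"
  have "inj_on (map_prod f f) (parcs X)"
    by (rule inj_on_subset[OF map_prod_inj_on[OF inj inj]]) (auto dest: X.in_arcsD1 X.in_arcsD2)
  then have iso: "pre_digraph.digraph_isomorphism (with_proj X) h"
    using inj X.wf_digraph_axioms by (auto simp: pre_digraph.digraph_isomorphism_def h_def)
  have "arcs H = map_prod f f ` parcs X"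
  proof (intro equalityI subsetI)
    fix e assume "e \<in> arcs H"
    then obtain u v where "u \<in> pverts X" "v \<in> pverts X" "e = (f u, f v)" "e \<in> parcs G"
      by (cases e) (auto simp: H_def)
    then show "e \<in> map_prod f f ` parcs X" using arcs by (auto intro!: rev_image_eqI[of "(u, v)"])
  next
    fix e assume "e \<in> map_prod f f ` parcs X"
    then show "e \<in> arcs H" using arcs by (auto simp: H_def dest: X.in_arcsD1 X.in_arcsD2)
  qed
  then have "H = app_iso h (with_proj X)"
    by (simp add: H_def app_iso_def h_def induce_subgraph_def)
  moreover have "induced_subgraph H (with_proj G)"
    unfolding H_def using sub G.wf_digraph_axioms by (intro wf_digraph.induced_induce) auto
  ultimately show False
    using assms(1,2) iso unfolding family_free_def digraph_iso_def by blast
qed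

lemma undirected_graph_simps:
  "pverts (undirected_graph V E) = V" "parcs (undirected_graph V E) = E \<union> E\<inverse>"
  by (simp_all add: undirected_graph_def)

lemma pair_wf_undirected_graph:
  assumes "E \<subseteq> V \<times> V"
  shows "pair_wf_digraph (undirected_graph V E)"
  using assms by unfold_locales (auto simp: undirected_graph_simps)

section \<open>Numbering the pairs of indices\<close>

text \<open>The code equals \<open>triangle (j - 1) + i\<close>, which lists the pairs by increasing
  \<open>j\<close> and then by \<open>i\<close>. The pairs up to \<open>p\<close> fill an initial
  segment of length \<open>triangle p\<close>, and \<open>(p - 1, p)\<close> is its last
  element.\<close>

lemma prod_encode_less_triangle:
  assumes "i < j" "j \<le> p"
  shows "prod_encode (i, j - Suc i) < p * (p + 1) div 2"
    and "(i, j) \<noteq> (p - 1, p) \<Longrightarrow> prod_encode (i, j - Suc i) < p * (p + 1) div 2 - 1"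
proof -
  have mono: "triangle m \<le> triangle n" if "m \<le> n" for m n
    using that by (induction rule: dec_induct) auto
  obtain k where k: "j = Suc k" using assms(1) by (cases j) auto
  then have code: "prod_encode (i, j - Suc i) = triangle k + i"
    using assms(1) by (simp add: prod_encode_def)
  have tri: "p * (p + 1) div 2 = triangle p" by (simp add: triangle_def)
  have "triangle k + Suc k \<le> triangle p" using mono[OF assms(2)] k by simp
  then show "prod_encode (i, j - Suc i) < p * (p + 1) div 2"
    using code tri k assms(1) by simp
  show "prod_encode (i, j - Suc i) < p * (p + 1) div 2 - 1" if "(i, j) \<noteq> (p - 1, p)"
  proof (cases "j = p")
    case True
    then show ?thesis using that code tri k assms(1) by auto
  next
    case False
    then have "triangle (Suc (Suc k)) \<le> triangle p" using k assms(2) by (intro mono) simp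
    then show ?thesis using code tri k assms(1) by simp
  qed
qed

section \<open>Forbidden adjacency patterns\<close>

locale butterfly_hammer_free = pair_graph G for G :: "'a pair_pre_digraph" and p :: nat +
  assumes free: "family_free {butterfly, hammer, P4_join_K p} (with_proj G)"
begin

abbreviation adj :: "'a \<Rightarrow> 'a \<Rightarrow> bool" where
  "adj u v \<equiv> (u, v) \<in> parcs G"

lemma adj_sym: "adj u v \<longleftrightarrow> adj v u"
  using sym_arcs by (auto simp: symmetric_def elim: symE)

lemma adj_irrefl: "\<not> adj u u"
  using no_loops' by blast

lemma no_butterfly:
  assumes "adj a b" "adj a c" "adj b c" "adj x y" "adj a x" "adj a y"
    and "\<not> adj b x" "\<not> adj b y" "\<not> adj c x" "\<not> adj c y"
  shows False
proof -
  define f where "f n = [a, b, c, x, y] ! n" for n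
  have f: "f 0 = a" "f (Suc 0) = b" "f 2 = c" "f 3 = x" "f 4 = y"
    by (auto simp: f_def numeral_eq_Suc)
  have V: "pverts butterfly = {0, 1, 2, 3, 4}"
    by (auto simp: butterfly_def undirected_graph_simps)
  show False
  proof (rule family_free_embedding[OF free, of butterfly f])
    show "pair_wf_digraph G" "pair_wf_digraph butterfly"
      unfolding butterfly_def by (auto intro!: pair_wf_undirected_graph)
    \<comment> \<open>The adjacency pattern forces the five vertices to be distinct; for example
      \<open>b = x\<close> would give \<open>adj c x\<close>.\<close>
    show "inj_on f (pverts butterfly)"
      unfolding V using assms by (auto simp: f adj_sym adj_irrefl)
    show "f ` pverts butterfly \<subseteq> pverts G"
      unfolding V using assms by (auto simp: f dest: in_arcsD1 in_arcsD2)
    have "\<forall>u\<in>pverts butterfly. \<forall>v\<in>pverts butterfly. (u, v) \<in> parcs butterfly \<longleftrightarrow> adj (f u) (f v)"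
      using assms unfolding V
      by (simp add: f butterfly_def undirected_graph_def adj_sym adj_irrefl)
    then show "(u, v) \<in> parcs butterfly \<longleftrightarrow> adj (f u) (f v)"
      if "u \<in> pverts butterfly" "v \<in> pverts butterfly" for u v
      using that by blast
  qed simp
qed

lemma no_hammer:
  assumes "adj a b" "adj b c" "adj a c" "adj c x" "adj x y"
    and "\<not> adj a x" "\<not> adj b x" "\<not> adj a y" "\<not> adj b y" "\<not> adj c y"
  shows False
proof -
  define f where "f n = [a, b, c, x, y] ! n" for n
  have f: "f 0 = a" "f (Suc 0) = b" "f 2 = c" "f 3 = x" "f 4 = y"
    by (auto simp: f_def numeral_eq_Suc)
  have V: "pverts hammer = {0, 1, 2, 3, 4}"
    by (auto simp: hammer_def undirected_graph_simps)
  show False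
  proof (rule family_free_embedding[OF free, of hammer f])
    show "pair_wf_digraph G" "pair_wf_digraph hammer"
      unfolding hammer_def by (auto intro!: pair_wf_undirected_graph)
    show "inj_on f (pverts hammer)"
      unfolding V using assms by (auto simp: f adj_sym adj_irrefl)
    show "f ` pverts hammer \<subseteq> pverts G"
      unfolding V using assms by (auto simp: f dest: in_arcsD1 in_arcsD2)
    have "\<forall>u\<in>pverts hammer. \<forall>v\<in>pverts hammer. (u, v) \<in> parcs hammer \<longleftrightarrow> adj (f u) (f v)"
      using assms unfolding V
      by (simp add: f hammer_def undirected_graph_def adj_sym adj_irrefl)
    then show "(u, v) \<in> parcs hammer \<longleftrightarrow> adj (f u) (f v)"
      if "u \<in> pverts hammer" "v \<in> pverts hammer" for u v
      using that by blast
  qed simp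
qed

text \<open>A clique \<open>K\<close> of size at least \<open>p\<close> contains one of size exactly
  \<open>p\<close>, so applications only have to bound the number of vertices joined to the path
  from below.\<close>

lemma no_P4_join_K:
  assumes path: "adj x1 x2" "adj x2 x3" "adj x3 x4"
    and nonadj: "\<not> adj x1 x3" "\<not> adj x1 x4" "\<not> adj x2 x4"
    and K: "finite K" "card K \<ge> p" "\<And>k l. k \<in> K \<Longrightarrow> l \<in> K \<Longrightarrow> k \<noteq> l \<Longrightarrow> adj k l"
    and join: "\<And>k. k \<in> K \<Longrightarrow> adj x1 k \<and> adj x2 k \<and> adj x3 k \<and> adj x4 k"
  shows False
proof -
  obtain K' where K': "K' \<subseteq> K" "card K' = p" using K(1,2) by (meson obtain_subset_with_card_n)
  then have "finite K'" using K(1) finite_subset by blast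
  then obtain g where "bij_betw g {4..<4 + p} K'"
    using K' by (metis bij_betw_iff_card card_atLeastLessThan diff_add_inverse finite_atLeastLessThan)
  then have g_inj: "inj_on g {4..<4 + p}" and g_im: "g ` {4..<4 + p} = K'"
    by (auto simp: bij_betw_def)
  define f where "f n = (if n < 4 then [x1, x2, x3, x4] ! n else g n)" for n
  have f: "f 0 = x1" "f (Suc 0) = x2" "f 2 = x3" "f 3 = x4"
    by (auto simp: f_def numeral_eq_Suc)
  have fg: "f n = g n" "g n \<in> K" if "n \<in> {4..<4 + p}" for n
    using that g_im K' by (auto simp: f_def)
  have path_verts: "pverts (path_graph 4) = {0, 1, 2, 3}"
    by (auto simp: path_graph_def undirected_graph_simps)
  have K_verts: "pverts (complete_graph {4..<4 + p}) = {4..<4 + p}"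
    by (simp add: complete_graph_def undirected_graph_simps)
  have path_arcs: "parcs (path_graph 4) = {(0,1),(1,2),(2,3),(1,0),(2,1),(3,2)}"
    by (auto simp: path_graph_def undirected_graph_simps)
  have K_arcs: "parcs (complete_graph {4..<4 + p}) = {(u, v). u \<in> {4..<4 + p} \<and> v \<in> {4..<4 + p} \<and> u \<noteq> v}"
    by (auto simp: complete_graph_def undirected_graph_simps)
  have V: "pverts (P4_join_K p) = {0, 1, 2, 3} \<union> {4..<4 + p}"
    by (auto simp: P4_join_K_def graph_join_def undirected_graph_simps path_verts K_verts)
  have E: "(u, v) \<in> parcs (P4_join_K p) \<longleftrightarrow>
      (u, v) \<in> {(0,1),(1,2),(2,3),(1,0),(2,1),(3,2)} \<or> u \<in> {4..<4 + p} \<and> v \<in> {4..<4 + p} \<and> u \<noteq> v \<or>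
      u \<in> {0, 1, 2, 3} \<and> v \<in> {4..<4 + p} \<or> u \<in> {4..<4 + p} \<and> v \<in> {0, 1, 2, 3}" for u v
  proof -
    have "(u, v) \<in> parcs (path_graph 4) \<longleftrightarrow> (v, u) \<in> parcs (path_graph 4)"
      "(u, v) \<in> parcs (complete_graph {4..<4 + p}) \<longleftrightarrow> (v, u) \<in> parcs (complete_graph {4..<4 + p})"
      by (auto simp: path_graph_def complete_graph_def undirected_graph_simps)
    then have "(u, v) \<in> parcs (P4_join_K p) \<longleftrightarrow>
        (u, v) \<in> parcs (path_graph 4) \<or> (u, v) \<in> parcs (complete_graph {4..<4 + p}) \<or>
        u \<in> {0, 1, 2, 3} \<and> v \<in> {4..<4 + p} \<or> u \<in> {4..<4 + p} \<and> v \<in> {0, 1, 2, 3}"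
      by (simp only: P4_join_K_def graph_join_def undirected_graph_simps path_verts K_verts
          Un_iff converse_iff mem_Sigma_iff) blast
    then show ?thesis by (simp only: path_arcs K_arcs mem_Collect_eq case_prod_conv)
  qed
  have x_notin: "x1 \<notin> K" "x2 \<notin> K" "x3 \<notin> K" "x4 \<notin> K"
    using join adj_irrefl by blast+
  have g_adj: "adj (g m) (g n) \<longleftrightarrow> m \<noteq> n" if "m \<in> {4..<4 + p}" "n \<in> {4..<4 + p}" for m n
    using K(3)[OF fg(2)[OF that(1)] fg(2)[OF that(2)]] inj_on_eq_iff[OF g_inj that] adj_irrefl by metis
  have distinct: "distinct [x1, x2, x3, x4]"
    using path nonadj by (auto simp: adj_sym adj_irrefl)
  show False
  proof (rule family_free_embedding[OF free, of "P4_join_K p" f])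
    show "pair_wf_digraph G" ..
    show "pair_wf_digraph (P4_join_K p)"
      by unfold_locales (auto simp: V E)
    have "inj_on f {0, 1, 2, 3}" using distinct by (auto simp: f)
    moreover have "inj_on f {4..<4 + p}" using g_inj fg by (auto simp: inj_on_def)
    moreover have "f ` {0, 1, 2, 3} \<inter> f ` {4..<4 + p} = {}"
      using x_notin fg by (auto simp: f)
    ultimately show "inj_on f (pverts (P4_join_K p))"
      unfolding V by (subst inj_on_Un) blast
    have "f ` {4..<4 + p} \<subseteq> pverts G"
      using fg join by (force dest: in_arcsD2)
    then show "f ` pverts (P4_join_K p) \<subseteq> pverts G"
      unfolding V using path by (auto simp: f dest: in_arcsD1 in_arcsD2)
    show "(u, v) \<in> parcs (P4_join_K p) \<longleftrightarrow> adj (f u) (f v)"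
      if uv: "u \<in> pverts (P4_join_K p)" "v \<in> pverts (P4_join_K p)" for u v
    proof (cases "u < 4"; cases "v < 4")
      assume "u < 4" "v < 4"
      then have "u \<in> {0, 1, 2, 3}" "v \<in> {0, 1, 2, 3}" by auto
      then show ?thesis using path nonadj 
        unfolding E by (elim insertE emptyE) (simp_all add: f adj_sym adj_irrefl)
    next
      assume "u < 4" "\<not> v < 4"
      then have "u \<in> {0, 1, 2, 3}" "v \<in> {4..<4 + p}" using uv unfolding V by auto
      then show ?thesis using join fg unfolding E by (auto simp: f)
    next
      assume "\<not> u < 4" "v < 4"
      then have "v \<in> {0, 1, 2, 3}" "u \<in> {4..<4 + p}" using uv unfolding V by auto
      moreover from this have "adj (f v) (f u)" using join fg by (auto simp: f)
      ultimately show ?thesis using adj_sym unfolding E by blast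
    next
      assume "\<not> u < 4" "\<not> v < 4"
      then have "v \<in> {4..<4 + p}" "u \<in> {4..<4 + p}" using uv unfolding V by auto
      then show ?thesis using g_adj fg unfolding E by auto
    qed
  qed simp
qed

text \<open>If both ends of the edge \<open>x y\<close> saw \<open>c\<close>, the two triangles at
  \<open>c\<close> would form a butterfly; if just one did, the triangle with the path from
  \<open>c\<close> through that end to the other would be a hammer.\<close>

lemma edge_triangle:
  assumes "adj a b" "adj a c" "adj b c" "adj x y"
    and "\<not> adj x a" "\<not> adj y a" "\<not> adj x b" "\<not> adj y b"
  shows "\<not> adj x c \<and> \<not> adj y c"
  using no_butterfly[of c a b x y] no_hammer[of a b c x y] no_hammer[of a b c y x] assms adj_sym
  by blast

end

section \<open>A component with a fixed maximum clique, and its missed indices\<close>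

locale free_component = butterfly_hammer_free G p for G :: "'a pair_pre_digraph" and p +
  fixes C :: "'a set" and w :: nat and a :: "nat \<Rightarrow> 'a"
  assumes closed: "x \<in> C \<Longrightarrow> adj x y \<Longrightarrow> y \<in> C"
    and connected: "x \<in> C \<Longrightarrow> y \<in> C \<Longrightarrow> x \<rightarrow>\<^sup>*\<^bsub>with_proj G\<^esub> y"
    and a_inj: "inj_on a {..<w}"
    and a_in: "i < w \<Longrightarrow> a i \<in> C"
    and a_adj: "i < w \<Longrightarrow> j < w \<Longrightarrow> i \<noteq> j \<Longrightarrow> adj (a i) (a j)"
    and clique_le: "S \<subseteq> C \<Longrightarrow> (\<And>u v. u \<in> S \<Longrightarrow> v \<in> S \<Longrightarrow> u \<noteq> v \<Longrightarrow> adj u v) \<Longrightarrow> card S \<le> w"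
    and w_ge_3: "w \<ge> 3"
begin

definition missed :: "'a \<Rightarrow> nat set" where
  "missed x = {i. i < w \<and> \<not> adj x (a i)}"

lemma missed_lt: "i \<in> missed x \<Longrightarrow> i < w"
  by (simp add: missed_def)

lemma missed_clique: "i < w \<Longrightarrow> missed (a i) = {i}"
  using a_adj adj_irrefl by (auto simp: missed_def)

lemma missed_nonempty:
  assumes "x \<in> C"
  shows "missed x \<noteq> {}"
proof
  assume *: "missed x = {}"
  then have x: "adj x (a i)" if "i < w" for i using that by (auto simp: missed_def)
  then have "x \<notin> a ` {..<w}" using adj_irrefl by force
  then have "card (insert x (a ` {..<w})) = Suc w" by (simp add: card_image[OF a_inj])
  moreover have "card (insert x (a ` {..<w})) \<le> w"
  proof (rule clique_le)
    show "adj u v" if "u \<in> insert x (a ` {..<w})" "v \<in> insert x (a ` {..<w})" "u \<noteq> v" for u v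
      using that x x[THEN iffD1[OF adj_sym]] a_adj by auto
  qed (use assms a_in in auto)
  ultimately show False by simp
qed

text \<open>Exchanging \<open>a i\<close> for both \<open>x\<close> and \<open>y\<close> would turn
  the maximum clique into a clique of size \<open>w + 1\<close>.\<close>

lemma missed_singleton_nonadj:
  assumes "x \<in> C" "adj x y" "missed x = {i}" "missed y = {i}"
  shows False
proof -
  define B where "B = a ` ({..<w} - {i})"
  have i: "i < w" using assms(3) missed_lt by blast
  have xB: "adj x z" and yB: "adj y z" if "z \<in> B" for z
    using that assms(3,4) by (auto simp: B_def missed_def)
  then have notin: "x \<notin> B" "y \<notin> B" using adj_irrefl by blast+
  have "inj_on a ({..<w} - {i})" using a_inj by (rule inj_on_subset) auto
  then have "card B = w - 1" using i by (simp add: B_def card_image)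
  moreover have "finite B" by (simp add: B_def)
  moreover have "x \<noteq> y" using assms(2) adj_irrefl by blast
  ultimately have "card (insert x (insert y B)) = Suc w" using notin i by simp
  moreover have "card (insert x (insert y B)) \<le> w"
  proof (rule clique_le)
    show "insert x (insert y B) \<subseteq> C" using assms(1,2) closed a_in by (auto simp: B_def)
    have B: "adj u v" if "u \<in> B" "v \<in> B" "u \<noteq> v" for u v
      using that a_adj by (auto simp: B_def)
    show "adj u v" if "u \<in> insert x (insert y B)" "v \<in> insert x (insert y B)" "u \<noteq> v" for u v
      using that B xB yB assms(2) adj_sym by blast
  qed
  ultimately show False by simp
qed

lemma missed_two_common:
  assumes "x \<in> C" "adj x y" "i \<in> missed x \<inter> missed y" "j \<in> missed x \<inter> missed y" "i \<noteq> j"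
  shows False
proof -
  text \<open>The end points of edges avoiding the closed neighbourhood of the clique form a union of
    components, while the clique itself contains none of them.\<close>
  define Q where "Q = {x. missed x = {..<w} \<and> (\<exists>y. adj x y \<and> missed y = {..<w})}"
  \<comment> \<open>The edge \<open>u v\<close> misses two vertices of every triangle
    \<open>a k\<close>, \<open>a l\<close>, \<open>a m\<close>, so by \<open>edge_triangle\<close>
    it misses the third.\<close>
  have pair_all: "missed u = {..<w} \<and> missed v = {..<w}"
    if uv: "adj u v" "k \<in> missed u \<inter> missed v" "l \<in> missed u \<inter> missed v" "k \<noteq> l" for u v k l
  proof -
    have "m \<in> missed u \<and> m \<in> missed v" if m: "m < w" for m
    proof (cases "m = k \<or> m = l")
      case False
      then show ?thesis
        using edge_triangle[of "a k" "a l" "a m" u v] uv a_adj m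
        by (auto simp: missed_def)
    qed (use uv in auto)
    then show ?thesis using missed_lt by auto
  qed
  have step: "z \<in> Q" if uz: "u \<in> Q" "adj u z" for u z
  proof -
    obtain v where v: "adj u v" "missed v = {..<w}" "missed u = {..<w}"
      using uz(1) unfolding Q_def by blast
    have "missed z = {..<w}"
    proof (rule ccontr)
      assume "missed z \<noteq> {..<w}"
      then obtain k where k: "k < w" "adj z (a k)" by (auto simp: missed_def)
      show False
      proof (cases "\<exists>l<w. l \<noteq> k \<and> adj z (a l)")
        case True
        \<comment> \<open>Now \<open>a k\<close>, \<open>a l\<close>, \<open>z\<close> is a
          triangle, and the edge \<open>u v\<close> misses two of its vertices, which forbids
          \<open>u\<close> from seeing the third, \<open>z\<close>.\<close>
        then obtain l where l: "l < w" "l \<noteq> k" "adj z (a l)" by blast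
        have "\<not> adj u z"
          using edge_triangle[of "a k" "a l" z u v] k l v adj_sym a_adj by (auto simp: missed_def)
        then show False using uz by blast
      next
        case False
        \<comment> \<open>\<open>l\<close> and \<open>m\<close> are two distinct indices among
          \<open>0\<close>, \<open>1\<close>, \<open>2\<close> that avoid \<open>k\<close>; they lie
          below \<open>w\<close> because \<open>w\<close> \<ge> 3.\<close>
        define l where "l = (if k = 0 then 1 else 0::nat)"
        define m where "m = (if k = 2 then 1 else 2::nat)"
        have lm: "l < w" "m < w" "l \<noteq> m" "l \<noteq> k" "m \<noteq> k"
          using w_ge_3 by (auto simp: l_def m_def)
        then have "l \<in> missed u \<inter> missed z" "m \<in> missed u \<inter> missed z"
          using False v by (auto simp: missed_def)
        then have "missed z = {..<w}" using pair_all uz(2) lm(3) by blast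
        then show False using k by (auto simp: missed_def)
      qed
    qed
    then show ?thesis using uz(2) v(3) adj_sym by (auto simp: Q_def)
  qed
  have "x \<rightarrow>\<^sup>*\<^bsub>with_proj G\<^esub> a 0" using connected assms(1) a_in w_ge_3 by simp
  moreover have "x \<in> Q" using pair_all[OF assms(2-5)] assms(2) by (auto simp: Q_def)
  ultimately have "a 0 \<in> Q"
    by (induction rule: converse_reachable_induct) (auto dest: step)
  then have "{0} = {..<w}" using missed_clique[of 0] w_ge_3 by (auto simp: Q_def)
  then show False using w_ge_3 by (metis lessThan_iff less_le_trans numeral_3_eq_3 singletonD Suc_n_not_n zero_less_Suc Suc_less_eq)
qed

text \<open>If \<open>u\<close> is missed by \<open>x\<close> but not by \<open>y\<close>, then
  \<open>x\<close>, \<open>y\<close>, \<open>a u\<close>, \<open>a i\<close> is an induced path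
  joined to every \<open>a k\<close> with \<open>k\<close> in \<open>K\<close>. If no index
  separates the two missed sets, either both are \<open>{i}\<close>, against
  \<open>missed_singleton_nonadj\<close>, or they share a second index, against
  \<open>missed_two_common\<close>.\<close>

lemma missed_common:
  assumes "x \<in> C" "adj x y" "i \<in> missed x \<inter> missed y"
    and K: "K \<subseteq> {..<w} - (missed x \<union> missed y)" "card K \<ge> p"
  shows False
proof -
  have P4: False if xy: "adj x y" "i \<in> missed x \<inter> missed y" "u \<in> missed x - missed y"
      "K \<subseteq> {..<w} - (missed x \<union> missed y)" for x y u
  proof (rule no_P4_join_K[of x y "a u" "a i" "a ` K"])
    have "inj_on a K" using a_inj xy(4) by (auto intro: inj_on_subset)
    then show "p \<le> card (a ` K)" using K(2) by (simp add: card_image)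
    show "finite (a ` K)" using K(1) by (auto intro: finite_subset)
    show "adj (a u) (a i)" using xy by (intro a_adj) (auto simp: missed_def)
    show "adj k l" if "k \<in> a ` K" "l \<in> a ` K" "k \<noteq> l" for k l
      using that K(1) a_adj by auto
    show "adj x k \<and> adj y k \<and> adj (a u) k \<and> adj (a i) k" if k: "k \<in> a ` K" for k
      using k xy a_adj by (auto simp: missed_def)
  qed (use xy in \<open>auto simp: missed_def\<close>)
  consider "missed x = {i}" "missed y = {i}" | u where "u \<in> missed x - missed y"
    | u where "u \<in> missed y - missed x" | u where "u \<in> missed x \<inter> missed y" "u \<noteq> i"
    using assms(3) by blast
  then show False
  proof cases
    case 1
    then show False using missed_singleton_nonadj assms by blast
  next
    case 2
    then show False using P4 assms by blast
  next
    case 3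
    then show False using P4[of y x] assms adj_sym by blast
  next
    case 4
    then show False using missed_two_common assms by blast
  qed
qed

text \<open>Two induced paths are used. If \<open>y l\<close> and \<open>y m\<close> were not
  adjacent, \<open>y l\<close>, \<open>a m\<close>, \<open>a l\<close>, \<open>y m\<close> would be
  joined to \<open>a n\<close> and to the clique vertices over \<open>K\<close>. Hence the three
  \<open>y\<close> are pairwise adjacent, and \<open>x\<close>, \<open>y i\<close>,
  \<open>a j\<close>, \<open>a i\<close> is joined to \<open>y k\<close> and to the clique vertices
  over \<open>K\<close>. Each time the extra vertex brings the joined clique to size at least
  \<open>p\<close>.\<close>

lemma missed_triple:
  assumes ijk: "distinct [i, j, k]" "{i, j, k} \<subseteq> missed x"
    and K: "K \<subseteq> {..<w} - missed x" "Suc (card K) \<ge> p"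
    and y: "\<And>l. l \<in> {i, j, k} \<Longrightarrow> adj x (y l) \<and> missed (y l) \<inter> (K \<union> {i, j, k}) = {l}"
  shows False
proof -
  have fin: "finite K" using K(1) finite_subset by blast
  have lt: "l < w" if "l \<in> K \<union> {i, j, k}" for l
    using that K(1) ijk(2) missed_lt by auto
  have inj_a: "inj_on a L" if "L \<subseteq> K \<union> {i, j, k}" for L
    using that lt by (intro inj_on_subset[OF a_inj]) auto
  have y_adj: "adj (y l) (a m) \<longleftrightarrow> m \<noteq> l" if "l \<in> {i, j, k}" "m \<in> K \<union> {i, j, k}" for l m
    using y[OF that(1)] that(2) lt[OF that(2)] by (auto simp: missed_def)
  have disj: "{i, j, k} \<inter> K = {}" using K(1) ijk(2) by blast
  have aK: "adj (a l) (a m)" if "l \<in> K \<union> {i, j, k}" "m \<in> K \<union> {i, j, k}" "l \<noteq> m" for l m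
    using that lt a_adj by blast
  have yy: "adj (y l) (y m)"
    if lmn: "l \<in> {i, j, k}" "m \<in> {i, j, k}" "n \<in> {i, j, k}" "distinct [l, m, n]" for l m n
  proof (rule ccontr)
    assume nonadj: "\<not> adj (y l) (y m)"
    have inj: "inj_on a (insert n K)" using lmn(3) by (intro inj_a) auto
    show False
    proof (rule no_P4_join_K[of "y l" "a m" "a l" "y m" "a ` insert n K"])
      show "p \<le> card (a ` insert n K)" using K(2) lmn disj fin by (subst card_image[OF inj]) auto
      show "adj u v" if "u \<in> a ` insert n K" "v \<in> a ` insert n K" "u \<noteq> v" for u v
        using that lmn(3) aK by blast
      show "adj (y l) u \<and> adj (a m) u \<and> adj (a l) u \<and> adj (y m) u" if u: "u \<in> a ` insert n K" for u
      proof -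
        obtain q where q: "q \<in> insert n K" "u = a q" using u by blast
        then have qq: "q \<in> K \<union> {i, j, k}" "q \<noteq> l" "q \<noteq> m" using lmn disj by auto
        then show ?thesis
          using q(2) y_adj[OF lmn(1) qq(1)] y_adj[OF lmn(2) qq(1)] 
            aK[OF UnI2[OF lmn(1)] qq(1) qq(2)[symmetric]] aK[OF UnI2[OF lmn(2)] qq(1) qq(3)[symmetric]] by simp
      qed
      show "adj (a l) (y m)" "\<not> adj (a m) (y m)"
        using y_adj[OF lmn(2) UnI2[OF lmn(1)]] y_adj[OF lmn(2) UnI2[OF lmn(2)]] lmn(4)
        by (simp_all add: adj_sym)
      show "adj (y l) (a m)" "\<not> adj (y l) (a l)" "adj (a m) (a l)"
        using y_adj[OF lmn(1) UnI2[OF lmn(2)]] y_adj[OF lmn(1) UnI2[OF lmn(1)]]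
          aK[OF UnI2[OF lmn(2)] UnI2[OF lmn(1)]] lmn(4) by simp_all
    qed (use nonadj fin in simp_all)
  qed
  let ?K = "insert (y k) (a ` K)"
  have yk: "adj (y k) (a q)" if "q \<in> K" for q using y_adj that disj by blast
  then have "y k \<notin> a ` K" using adj_irrefl by force
  moreover have "inj_on a K" by (intro inj_a) auto
  ultimately have card: "p \<le> card ?K" using K(2) fin by (simp add: card_image)
  have xa: "\<not> adj x (a l)" if "l \<in> {i, j, k}" for l using ijk(2) that by (auto simp: missed_def)
  have xK: "adj x (a q)" if "q \<in> K" for q using K(1) that by (auto simp: missed_def)
  show False
  proof (rule no_P4_join_K[of x "y i" "a j" "a i" ?K])
    show "adj u v" if "u \<in> ?K" "v \<in> ?K" "u \<noteq> v" for u v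
      using that yk yk[THEN iffD1[OF adj_sym]] aK by auto
    have "adj (a j) (y k)" "adj (a i) (y k)"
      using y_adj[of k j] y_adj[of k i] ijk(1) adj_sym by auto
    moreover have "adj (y i) (y k)" using yy[of i k j] ijk(1) by auto
    moreover have "adj x (y k)" using y by blast
    moreover have "adj x (a q) \<and> adj (y i) (a q) \<and> adj (a j) (a q) \<and> adj (a i) (a q)" if "q \<in> K" for q
      using xK[OF that] y_adj[of i q] aK[of j q] aK[of i q] that disj by auto
    ultimately show "adj x u \<and> adj (y i) u \<and> adj (a j) u \<and> adj (a i) u" if "u \<in> ?K" for u
      using that by auto
    show "adj (y i) (a j)" "\<not> adj (y i) (a i)" using y_adj ijk(1) by auto
    show "adj (a j) (a i)" using aK ijk(1) by auto
  qed (use card fin xa y in auto)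
qed

section \<open>Colouring one component\<close>

text \<open>A vertex may admit several colours; as adjacent vertices never admit a common one, every
  selection is proper, and each colour can be studied separately.\<close>

lemma ex_colouring_from_choices:
  assumes "\<And>x. x \<in> C \<Longrightarrow> \<exists>c<n. R x c"
    and "\<And>x y c. x \<in> C \<Longrightarrow> y \<in> C \<Longrightarrow> adj x y \<Longrightarrow> R x c \<Longrightarrow> R y c \<Longrightarrow> False"
  shows "\<exists>c. (\<forall>x\<in>C. c x < n) \<and> (\<forall>x\<in>C. \<forall>y\<in>C. adj x y \<longrightarrow> c x \<noteq> (c y :: nat))"
proof -
  obtain c where "\<forall>x\<in>C. c x < n \<and> R x (c x)" using assms(1) by metis
  then show ?thesis using assms(2) by metis
qed

text \<open>\<open>prod_encode\<close> is injective, and \<open>i < j\<close> lets \<open>j\<close>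
  be recovered from \<open>j - Suc i\<close>; equal codes thus mean two common missed
  indices.\<close>

lemma pair_code_conflict:
  assumes "x \<in> C" "adj x y" "{i, j} \<subseteq> missed x" "{i', j'} \<subseteq> missed y" "i < j" "i' < j'"
    and "prod_encode (i, j - Suc i) = prod_encode (i', j' - Suc i')"
  shows False
proof -
  have "i = i'" "j = j'" using assms(5-7) by auto
  then show False using missed_two_common assms by auto
qed

lemma colouring_general:
  "\<exists>c. (\<forall>x\<in>C. c x < w + p * (p + 1) div 2) \<and> (\<forall>x\<in>C. \<forall>y\<in>C. adj x y \<longrightarrow> c x \<noteq> (c y :: nat))"
proof (rule ex_colouring_from_choices)
  let ?T = "p * (p + 1) div 2"
  define pair where "pair x c \<longleftrightarrow>
    (\<exists>i j. {i, j} \<subseteq> missed x \<and> i < j \<and> j \<le> p \<and> c = prod_encode (i, j - Suc i))" for x c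
  \<comment> \<open>The index \<open>i\<close> lies above \<open>p\<close> exactly when
    \<open>x\<close> misses no index up to \<open>p\<close>.\<close>
  define single where "single x c \<longleftrightarrow>
    (\<exists>i\<in>missed x. missed x \<inter> {..p} \<subseteq> {i} \<and> c = ?T + i)" for x c
  have pair_lt: "c < ?T" if "pair x c" for x c
    using that prod_encode_less_triangle(1) by (auto simp: pair_def)
  show "\<exists>c<w + ?T. pair x c \<or> single x c" if "x \<in> C" for x
  proof (cases "\<exists>i j. {i, j} \<subseteq> missed x \<and> i < j \<and> j \<le> p")
    case True
    then obtain c where "pair x c" by (auto simp: pair_def)
    then show ?thesis using pair_lt by (meson trans_less_add2)
  next
    case False
    have "\<exists>i\<in>missed x. missed x \<inter> {..p} \<subseteq> {i}"
    proof (cases "missed x \<inter> {..p} = {}")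
      case True
      then show ?thesis using missed_nonempty[OF that] by blast
    next
      case ne: False
      then obtain i where i: "i \<in> missed x" "i \<le> p" by auto
      moreover have "l = i" if "l \<in> missed x" "l \<le> p" for l
        using False i that by (metis bot.extremum insert_subset linorder_neqE_nat)
      ultimately show ?thesis by blast
    qed
    then obtain i where "i \<in> missed x" "single x (?T + i)" by (auto simp: single_def)
    then show ?thesis using missed_lt by (metis add.commute add_less_cancel_left)
  qed
  show False if xy: "x \<in> C" "adj x y" "pair x c \<or> single x c" "pair y c \<or> single y c" for x y c
  proof -
    consider "pair x c" "pair y c" | "single x c" "single y c"
      using xy(3,4) pair_lt by (auto simp: single_def)
    then show False
    proof cases
      case 1
      then show False using pair_code_conflict[OF xy(1,2)] unfolding pair_def by metis
    next
      case 2
      then obtain i where i: "i \<in> missed x \<inter> missed y"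
        "missed x \<inter> {..p} \<subseteq> {i}" "missed y \<inter> {..p} \<subseteq> {i}"
        by (auto simp: single_def)
      show False
      \<comment> \<open>For \<open>p < w\<close> all of \<open>{..p}\<close> are clique indices, and
        at least \<open>p\<close> of them differ from \<open>i\<close>. Otherwise
        \<open>{..p}\<close> contains every clique index, so both missed sets are
        \<open>{i}\<close>.\<close>
      proof (cases "p < w")
        case True
        show False
        proof (rule missed_common[OF xy(1,2) i(1)])
          show "{..p} - {i} \<subseteq> {..<w} - (missed x \<union> missed y)" using True i by auto
        qed (simp add: card_Diff_singleton_if)
      next
        case False
        then have "missed x = {i}" "missed y = {i}" using i missed_lt by force+
        then show False using missed_singleton_nonadj xy by blast
      qed
    qed
  qed
qed

text \<open>Dropping the last code, that of \<open>(p - 1, p)\<close>, leaves \<open>T\<close> pair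
  colours and a total of \<open>T + w\<close>. As \<open>w\<close> \<ge> \<open>p + 2\<close>, the
  window \<open>{..Suc p}\<close> consists of \<open>p + 2\<close> clique indices, so
  \<open>p\<close> remain whenever at most two are removed.\<close>

lemma colouring_large_clique:
  assumes "p \<ge> 1" "w \<ge> p + 2"
  shows "\<exists>c. (\<forall>x\<in>C. c x < w + p * (p + 1) div 2 - 1) \<and>
             (\<forall>x\<in>C. \<forall>y\<in>C. adj x y \<longrightarrow> c x \<noteq> (c y :: nat))"
proof (rule ex_colouring_from_choices)
  define T where "T = p * (p + 1) div 2 - 1"
  have "p * (p + 1) div 2 \<ge> 1"
    using prod_encode_less_triangle(1)[of 0 1 p] assms(1) by simp
  then have T: "w + p * (p + 1) div 2 - 1 = T + w" by (simp add: T_def)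
  define q where "q = p - 1"
  have q: "p = Suc q" using assms(1) by (simp add: q_def)
  define win where "win x = missed x \<inter> {..Suc p}" for x
  have win_iff: "l \<in> missed x \<longleftrightarrow> l \<in> win x" if "l \<le> Suc p" for l x
    using that by (auto simp: win_def)
  define pair where "pair x c \<longleftrightarrow>
    (\<exists>i j. {i, j} \<subseteq> missed x \<and> i < j \<and> j \<le> p \<and> (i, j) \<noteq> (q, p) \<and>
      c = prod_encode (i, j - Suc i))" for x c
  text \<open>Two different two-element sets with the same colour would leave only \<open>p - 1\<close> indices outside
    their union, one too few for \<open>missed_common\<close>; the cyclic choice gives each colour one such set.\<close>
  define two where "two x i \<longleftrightarrow> (win x, i) \<in> {({q, p}, q), ({p, Suc p}, p), ({q, Suc p}, Suc p)}" for x i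
  \<comment> \<open>A vertex missing the whole triple takes an index of it that no neighbour misses
    alone in the window; this avoids conflicts with neighbours whose window set is
    \<open>{i}\<close>.\<close>
  define three where "three x i \<longleftrightarrow> win x = {q, p, Suc p} \<and> i \<in> {q, p, Suc p} \<and>
     (\<forall>y. adj x y \<longrightarrow> win y \<noteq> {i})" for x i
  \<comment> \<open>For \<open>i < q\<close> nothing is demanded at \<open>Suc p\<close>: the window
    set then lies in \<open>{i, Suc p}\<close>, which still has only two elements.\<close>
  define single where "single x i \<longleftrightarrow>
    (if i < q then missed x \<inter> {..p} \<subseteq> {i} else win x \<subseteq> {i} \<or> two x i \<or> three x i)" for x i
  define R where "R x c \<longleftrightarrow> pair x c \<or> (\<exists>i\<in>missed x. single x i \<and> c = T + i)" for x c
  have pair_lt: "c < T" if "pair x c" for x c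
    using that prod_encode_less_triangle(2) by (auto simp: pair_def T_def q_def)
  have three_ex: "\<exists>i. three x i" if "win x = {q, p, Suc p}" for x
  proof (rule ccontr)
    assume "\<not> ?thesis"
    then have "\<forall>i\<in>{q, p, Suc p}. \<exists>y. adj x y \<and> win y = {i}" using that by (auto simp: three_def)
    then obtain y where y: "\<And>i. i \<in> {q, p, Suc p} \<Longrightarrow> adj x (y i) \<and> win (y i) = {i}" by metis
    show False
    \<comment> \<open>\<open>missed_triple\<close> asks for \<open>p - 1\<close> further indices,
      and \<open>{..<q}\<close> provides them: together with the triple it makes up the
      window.\<close>
    proof (rule missed_triple[of q p "Suc p" x "{..<q}" y])
      show "{q, p, Suc p} \<subseteq> missed x" using that by (auto simp: win_def)
      show "{..<q} \<subseteq> {..<w} - missed x"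
        using that assms(2) q win_iff[of _ x] by auto
      have "{..<q} \<union> {q, p, Suc p} = {..Suc p}" using q by auto
      then show "adj x (y l) \<and> missed (y l) \<inter> ({..<q} \<union> {q, p, Suc p}) = {l}" if "l \<in> {q, p, Suc p}" for l
        using y[OF that] by (simp add: win_def)
    qed (use q in auto)
  qed
  have choice: "(\<exists>c. pair x c) \<or> (\<exists>i\<in>missed x. single x i)" if "x \<in> C" for x
  proof (cases "\<exists>c. pair x c")
    case False
    then have no_pair: "(i, j) = (q, p)" if "i \<in> missed x" "j \<in> missed x" "i < j" "j \<le> p" for i j
      using that unfolding pair_def by blast
    show ?thesis
    proof (cases "\<exists>i\<in>missed x. i < q")
      case True
      \<comment> \<open>The one pair that \<open>no_pair\<close> allows is \<open>(q, p)\<close>, so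
        next to an index \<open>i < q\<close> no other index up to \<open>p\<close> is
        missed.\<close>
      then obtain i where i: "i \<in> missed x" "i < q" by blast
      have "l = i" if "l \<in> missed x" "l \<le> p" for l
        using no_pair[of i l] no_pair[of l i] i that q by force
      then have "single x i" using i by (auto simp: single_def)
      then show ?thesis using i by blast
    next
      case False
      then have win_sub: "win x \<subseteq> {q, p, Suc p}" using q by (auto simp: win_def)
      have ge: "\<not> i < q" if "i \<in> missed x" for i using False that by blast
      consider "win x = {}" | i where "win x = {i}" | "win x = {q, p}" | "win x = {p, Suc p}"
        | "win x = {q, Suc p}" | "win x = {q, p, Suc p}"
        using win_sub by blast
      then show ?thesis
      proof cases
        case 1
        \<comment> \<open>With an empty window set, any missed index lies above \<open>Suc p\<close>
          and can serve as the colour.\<close>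
        then show ?thesis using missed_nonempty[OF that] ge by (auto simp: single_def)
      next
        case 2
        then have "i \<in> missed x" by (auto simp: win_def)
        then show ?thesis using 2 ge by (auto simp: single_def)
      next
        case 6
        then obtain i where "three x i" using three_ex by blast
        moreover from this have "i \<in> missed x" using 6 by (auto simp: three_def win_def)
        ultimately show ?thesis using ge by (auto simp: single_def)
      qed (use q in \<open>auto simp: single_def two_def win_iff\<close>)
    qed
  qed blast
  show "\<exists>c<w + p * (p + 1) div 2 - 1. R x c" if "x \<in> C" for x
    using choice[OF that] pair_lt missed_lt unfolding T R_def
    by (metis add_less_cancel_left trans_less_add1)
  have single_conflict: False
    if xy: "x \<in> C" "adj x y" "i \<in> missed x \<inter> missed y" "single x i" "single y i" for x y i
  proof -
    have common: False if "win x \<union> win y \<subseteq> W" "card W \<le> 2" "W \<subseteq> {..Suc p}" for W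
    proof (rule missed_common[OF xy(1-3)])
      show "{..Suc p} - W \<subseteq> {..<w} - (missed x \<union> missed y)"
        using that(1) assms(2) by (auto simp: win_def)
      show "card ({..Suc p} - W) \<ge> p"
        using that(2,3) by (simp add: card_Diff_subset finite_subset)
    qed
    have two_common: False if "{l, m} \<subseteq> win x \<inter> win y" "l \<noteq> m" for l m
      using missed_two_common[OF xy(1,2), of l m] that by (auto simp: win_def)
    show False
    proof (cases "i < q")
      case True
      show False
      proof (rule common)
        show "win x \<union> win y \<subseteq> {i, Suc p}"
          using True xy(4,5) by (auto simp: single_def win_def le_Suc_eq)
      qed (use True q card_insert_le_m1[of 2 "{Suc p}" i] in auto)
    next
      case False
      \<comment> \<open>Cases 1 to 3 leave \<open>p\<close> window indices missed by neither vertex.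
        In cases 4 to 7 two missed indices are shared, since \<open>i\<close> determines the
        two-element set and this lies in the triple. In cases 8 and 9 a neighbour has window set
        \<open>{i}\<close>, which \<open>three\<close> excludes.\<close>
      then consider "win x \<subseteq> {i}" "win y \<subseteq> {i}" | "win x \<subseteq> {i}" "two y i" | "two x i" "win y \<subseteq> {i}"
        | "two x i" "two y i" | "three x i" "three y i" | "two x i" "three y i" | "three x i" "two y i"
        | "win x \<subseteq> {i}" "three y i" | "three x i" "win y \<subseteq> {i}"
        using xy(4,5) unfolding single_def by auto
      then show False
      proof cases
        case 1
        \<comment> \<open>\<open>i\<close> may exceed \<open>Suc p\<close>, and then both window
          sets are empty; the intersection keeps the covering set inside the window, as
          \<open>common\<close> demands.\<close>
        have "win x \<union> win y \<subseteq> {i} \<inter> {..Suc p}" using 1 by (auto simp: win_def)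
        moreover have "card ({i} \<inter> {..Suc p}) \<le> 2"
          using card_mono[of "{i}" "{i} \<inter> {..Suc p}"] by simp
        ultimately show False by (intro common) auto
      next
        case 2
        show False by (rule common[of "win y"]) (use 2 q in \<open>auto simp: two_def\<close>)
      next
        case 3
        show False by (rule common[of "win x"]) (use 3 q in \<open>auto simp: two_def\<close>)
      next
        case 4
        then show False using q two_common[of q p] two_common[of p "Suc p"] two_common[of q "Suc p"]
          by (auto simp: two_def)
      next
        case 5
        then show False using q two_common[of q p] by (auto simp: three_def)
      next
        case 6
        then show False using q two_common[of q p] two_common[of p "Suc p"] two_common[of q "Suc p"]
          by (auto simp: two_def three_def)
      next
        case 7
        then show False using q two_common[of q p] two_common[of p "Suc p"] two_common[of q "Suc p"]
          by (auto simp: two_def three_def)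
      next
        case 8
        then have "i \<in> win x" using xy(3) q by (auto simp: three_def win_def)
        then show False using 8 xy(2) adj_sym by (auto simp: three_def)
      next
        case 9
        then have "i \<in> win y" using xy(3) q by (auto simp: three_def win_def)
        then show False using 9 xy(2) by (auto simp: three_def)
      qed
    qed
  qed
  show False if xy: "x \<in> C" "y \<in> C" "adj x y" "R x c" "R y c" for x y c
  proof -
    consider "pair x c" "pair y c"
      | i where "i \<in> missed x \<inter> missed y" "single x i" "single y i"
      using xy(4,5) pair_lt by (force simp: R_def)
    then show False
    proof cases
      case 1
      then show False using pair_code_conflict[OF xy(1,3)] unfolding pair_def by metis
    next
      case 2
      then show False using single_conflict xy by blast
    qed
  qed
qed

end

section \<open>Clique numbers, and the passage from components to the graph\<close>

lemma clique_number_attained: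
  assumes "finite (verts H)"
  shows "\<exists>S. is_clique H S \<and> card S = clique_number H"
    and "is_clique H S \<Longrightarrow> card S \<le> clique_number H"
proof -
  have "{card S | S. is_clique H S} \<subseteq> card ` Pow (verts H)" by (auto simp: is_clique_def)
  then have fin: "finite {card S | S. is_clique H S}"
    using assms finite_subset by blast
  have "is_clique H {}" by (simp add: is_clique_def)
  then have "{card S | S. is_clique H S} \<noteq> {}" by blast
  then show "\<exists>S. is_clique H S \<and> card S = clique_number H"
    using Max_in[OF fin] by (auto simp: clique_number_def)
  show "card S \<le> clique_number H" if "is_clique H S"
    unfolding clique_number_def using that by (intro Max_ge[OF fin]) blast
qed

lemma is_clique_induce_subgraph:
  "is_clique (with_proj G \<restriction> C) S \<longleftrightarrow> S \<subseteq> C \<and> (\<forall>u\<in>S. \<forall>v\<in>S. u \<noteq> v \<longrightarrow> (u, v) \<in> parcs G)"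
  by (auto simp: is_clique_def arcs_ends_def arc_to_ends_def image_iff)

definition colour_bound :: "nat \<Rightarrow> nat \<Rightarrow> nat" where
  "colour_bound p w = (if w \<le> p + 1 then w + p * (p + 1) div 2 else w + p * (p + 1) div 2 - 1)"

text \<open>From \<open>w = p + 1\<close> to \<open>w = p + 2\<close> the loss of one is offset by
  the growth of \<open>w\<close>. Monotonicity carries the bound for a component, whose clique
  number may be smaller, over to \<open>G\<close>.\<close>

lemma colour_bound_mono: "w \<le> w' \<Longrightarrow> colour_bound p w \<le> colour_bound p w'"
  by (auto simp: colour_bound_def)

context butterfly_hammer_free
begin

text \<open>A component of clique number one has no edges and takes the constant colour
  \<open>0\<close>. Otherwise the clique number is at least three, as the analysis of missed indices
  requires.\<close>

lemma component_colouring: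
  assumes "p \<ge> 1" "u \<in> pverts G" and C: "C = {v. u \<rightarrow>\<^sup>*\<^bsub>with_proj G\<^esub> v}"
    and not_2: "clique_number (with_proj G \<restriction> C) \<noteq> 2"
  shows "\<exists>c. (\<forall>x\<in>C. c x < colour_bound p (clique_number (with_proj G))) \<and>
             (\<forall>x\<in>C. \<forall>y\<in>C. adj x y \<longrightarrow> c x \<noteq> (c y :: nat))"
proof -
  let ?H = "with_proj G \<restriction> C"
  define w where "w = clique_number ?H"
  have sub: "C \<subseteq> pverts G" using C reachable_in_verts by auto
  have fin: "finite C" using sub pair_finite_verts finite_subset by blast
  have u: "u \<in> C" using C assms(2) by simp
  have clique_le: "card S \<le> w" if "S \<subseteq> C" "\<And>x y. x \<in> S \<Longrightarrow> y \<in> S \<Longrightarrow> x \<noteq> y \<Longrightarrow> adj x y" for S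
    unfolding w_def using that fin by (intro clique_number_attained(2)) (auto simp: is_clique_induce_subgraph)
  obtain S where S: "S \<subseteq> C" "\<And>x y. x \<in> S \<Longrightarrow> y \<in> S \<Longrightarrow> x \<noteq> y \<Longrightarrow> adj x y" "card S = w"
    using clique_number_attained(1)[of ?H] fin by (auto simp: is_clique_induce_subgraph w_def)
  have "is_clique (with_proj G) S" using S sub by (auto simp: is_clique_def)
  then have w_le: "w \<le> clique_number (with_proj G)"
    using clique_number_attained(2)[of "with_proj G" S] S(3) pair_finite_verts by simp
  have "w \<ge> 1" using clique_le[of "{u}"] u by simp
  have "\<exists>c. (\<forall>x\<in>C. c x < colour_bound p w) \<and> (\<forall>x\<in>C. \<forall>y\<in>C. adj x y \<longrightarrow> c x \<noteq> (c y :: nat))"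
  proof (cases "w = 1")
    case True
    have "\<not> adj x y" if "x \<in> C" "y \<in> C" for x y
    proof
      assume xy: "adj x y"
      then have "x \<noteq> y" using adj_irrefl by blast
      moreover have "card {x, y} \<le> w"
        using that xy adj_sym[of x y] by (intro clique_le) auto
      ultimately show False using True by simp
    qed
    moreover have "0 < colour_bound p w" using True by (simp add: colour_bound_def)
    ultimately show ?thesis by (intro exI[of _ "\<lambda>_. 0"]) simp
  next
    case False
    then have "w \<ge> 3" using \<open>w \<ge> 1\<close> not_2 by (simp add: w_def)
    have "finite S" using S(1) fin finite_subset by blast
    then obtain a where a: "bij_betw a {..<w} S"
      using S(3) by (metis bij_betw_iff_card card_lessThan finite_lessThan)
    interpret free_component G p C w a
    proof
      show "y \<in> C" if "x \<in> C" "adj x y" for x y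
        using that C reachable_adj_trans by auto
      show "x \<rightarrow>\<^sup>*\<^bsub>with_proj G\<^esub> y" if "x \<in> C" "y \<in> C" for x y
        using that C symmetric_reachable[OF sym_arcs] reachable_trans by blast
      show "inj_on a {..<w}" using a by (simp add: bij_betw_def)
      have a_in: "a i \<in> S" if "i < w" for i using a that by (auto simp: bij_betw_def)
      show "a i \<in> C" if "i < w" for i using a_in[OF that] S(1) by blast
      show "adj (a i) (a j)" if "i < w" "j < w" "i \<noteq> j" for i j
      proof (rule S(2)[OF a_in[OF that(1)] a_in[OF that(2)]])
        show "a i \<noteq> a j" using that a by (auto simp: bij_betw_def dest: inj_onD)
      qed
    qed (use clique_le \<open>w \<ge> 3\<close> in blast)+
    show ?thesis
      using colouring_general colouring_large_clique assms(1) by (simp add: colour_bound_def)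
  qed
  then show ?thesis using colour_bound_mono[OF w_le] by (meson less_le_trans)
qed

text \<open>No edge runs between components, so the same \<open>?k\<close> colours serve in all of
  them.\<close>

lemma chromatic_number_le_colour_bound:
  assumes "p \<ge> 1" and "\<forall>C \<in> pre_digraph.sccs (with_proj G). clique_number C \<noteq> 2"
  shows "chromatic_number (with_proj G) \<le> colour_bound p (clique_number (with_proj G))"
proof -
  let ?k = "colour_bound p (clique_number (with_proj G))"
  let ?C = "\<lambda>u. {v. u \<rightarrow>\<^sup>*\<^bsub>with_proj G\<^esub> v}"
  define good where
    "good C c \<longleftrightarrow> (\<forall>x\<in>C. c x < ?k) \<and> (\<forall>x\<in>C. \<forall>y\<in>C. adj x y \<longrightarrow> c x \<noteq> c y)"
    for C and c :: "'a \<Rightarrow> nat"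
  have "\<forall>C\<in>?C ` pverts G. \<exists>c. good C c"
    using assms induce_reachable_is_in_sccs component_colouring by (auto simp: good_def)
  \<comment> \<open>\<open>c\<close> is indexed by the set \<open>?C u\<close> rather than by the
    vertex \<open>u\<close>, so that all vertices of a component use one colouring.\<close>
  then obtain c where c: "\<And>u. u \<in> pverts G \<Longrightarrow> good (?C u) (c (?C u))" by (metis image_eqI)
  have "proper_colouring (with_proj G) ?k (\<lambda>u. c (?C u) u)"
    unfolding proper_colouring_def with_proj_simps
  proof (intro conjI ballI impI)
    show "c (?C v) v < ?k" if "v \<in> pverts G" for v using c[OF that] that by (simp add: good_def)
    show "c (?C u) u \<noteq> c (?C v) v" if "u \<in> pverts G" "v \<in> pverts G" "adj u v" for u v
    proof -
      have uv: "u \<rightarrow>\<^sup>*\<^bsub>with_proj G\<^esub> v" using that(3) by simp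
      then have "v \<rightarrow>\<^sup>*\<^bsub>with_proj G\<^esub> u" by (rule symmetric_reachable[OF sym_arcs])
      then have eq: "?C u = ?C v" using uv reachable_trans by blast
      have "u \<in> ?C u" "v \<in> ?C u" using that(1) uv by simp_all
      then have "c (?C u) u \<noteq> c (?C u) v" using c[OF that(1)] that(3) unfolding good_def by blast
      then show ?thesis unfolding eq .
    qed
  qed
  then show ?thesis unfolding chromatic_number_def by (intro Least_le) blast
qed

end

theorem theorem3p9:
  fixes G :: "'a pair_pre_digraph" and p :: nat
  assumes "p \<ge> 1"
    and "pair_graph G"
    and "family_free {butterfly, hammer, P4_join_K p} (with_proj G)"
    and "\<forall>C \<in> pre_digraph.sccs (with_proj G). clique_number C \<noteq> 2"
  shows "(1 \<le> clique_number (with_proj G) \<and> clique_number (with_proj G) \<le> p + 1 \<longrightarrow>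
            chromatic_number (with_proj G) \<le> clique_number (with_proj G) + p * (p + 1) div 2) \<and>
         (clique_number (with_proj G) \<ge> p + 2 \<longrightarrow>
            chromatic_number (with_proj G) \<le> clique_number (with_proj G) + p * (p + 1) div 2 - 1)"
proof -
  interpret butterfly_hammer_free G p
    using assms(2,3) by (simp add: butterfly_hammer_free_def butterfly_hammer_free_axioms_def)
  show ?thesis
    using chromatic_number_le_colour_bound[OF assms(1,4)] by (auto simp: colour_bound_def split: if_splits)
qed

end
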